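(* Let $\sigma>0$ and let $(Y_1,X_1),\dots,(Y_n,X_n)$ be an i.i.d. sample of $(Y,X)$ obeying $Y=\int_0^1\beta(t)X(t)\,dt+\sigma\epsilon$. Let $\omega,\gamma,\upsilon$ be strictly positive sequences indexed by $j\ge1$ with $\omega_1=\gamma_1=\upsilon_1=1$ such that $\gamma$ and $(\gamma_j/\omega_j)_{j\ge1}$ are nondecreasing and $\upsilon$ is nonincreasing with $\sum_j\upsilon_j<\infty$. Suppose that $\epsilon\sim\mathcal N(0,1)$ is independent of the second order stationary regressor $X$, whose associated sequence of eigenvalues satisfies $(\lambda_j)_{j\ge1}\in\mathcal S^d_\upsilon$, $d\ge1$. Consider $\mathcal F^\rho_\gamma$, $\rho>0$, as set of slope functions. For some $\triangle\ge1$ let $k_n^*\in\mathbb N$ and $\delta_n^*>0$ be such that $$\frac1\triangle\le\frac{\gamma_{k_n^*}}{n\,\omega_{k_n^*}}\sum_{j=1}^{k_n^*}\frac{\omega_j}{\upsilon_j}\le\triangle\qquad\text{and}\qquad\delta_n^*:=\frac{\omega_{k_n^*}}{\gamma_{k_n^*}}.$$ Then for any estimator $\breve\beta$ (based on the sample), $$\sup_{\beta\in\mathcal F_\gamma^\rho}\mathbb E\|\breve\beta-\beta\|_\omega^2\ \ge\ \frac1{4\triangle}\min\Bigl(\frac{\sigma^2}{2d},\frac\rho\triangle\Bigr)\max(\delta_n^*,1/n).$$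
   Context: $L^2[0,1]$ has its usual inner product $\langle\cdot,\cdot\rangle$ and norm $\|\cdot\|$. Model: $Y=\int_0^1\beta(t)X(t)dt+\sigma\epsilon$, where $\beta\in L^2[0,1]$, $X$ is a random function with values in $L^2[0,1]$, centered, with $\mathbb E\|X\|^2<\infty$, and $\epsilon$ is a real error term with mean zero and variance one. The expectation is taken under the distribution of the sample with slope $\beta$. Trigonometric basis of $L^2[0,1]$: $\psi_1\equiv1$, $\psi_{2j}(s)=\sqrt2\cos(2\pi js)$, $\psi_{2j+1}(s)=\sqrt2\sin(2\pi js)$, $j\in\mathbb N=\{1,2,\dots\}$. $X$ is second order stationary: $\mathrm{Cov}(X(t),X(s))=c(t-s)$ for $s,t\in[0,1]$, with $c:[-1,1]\to\mathbb R$ positive definite. Its covariance operator is $(Tf)(s)=\int_0^1\mathrm{Cov}(X(t),X(s))f(t)dt$. Standing property: $T$ is strictly positive and diagonal in the trigonometric basis, $T\psi_j=\lambda_j\psi_j$ with $\lambda_j=\mathbb E\langle X,\psi_j\rangle^2>0$ for all $j\ge1$. For a strictly positive sequence $w=(w_j)_{j\ge1}$ and $\rho>0$: $\|f\|_w^2=\sum_{j\ge1}w_j|\langle f,\psi_j\rangle|^2$ and $\mathcal F_w^\rho=\{f\in L^2[0,1]:\|f\|_w^2\le\rho\}$. For $d\ge1$: $\mathcal S_\upsilon^d=\{(\lambda_j)_{j\ge1}:1/d\le\lambda_j/\upsilon_j\le d\ \ \forall j\in\mathbb N\}$. *)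

theory Defs
  imports "HOL-Probability.Probability"
begin

section \<open>The space of square integrable functions on the unit interval\<close>

text \<open>
  Elements of \<open>L\<^sup>2[0,1]\<close> are represented by square integrable functions, without passing to
  the quotient modulo null sets; only the values on \<open>[0,1]\<close> matter.
\<close>

abbreviation unit_lebesgue :: "real measure" where
  "unit_lebesgue \<equiv> lebesgue_on {0..1}"

definition L2 :: "(real \<Rightarrow> real) set" where
  "L2 = {f \<in> borel_measurable unit_lebesgue. integrable unit_lebesgue (\<lambda>t. (f t)\<^sup>2)}"

definition l2_inner :: "(real \<Rightarrow> real) \<Rightarrow> (real \<Rightarrow> real) \<Rightarrow> real" where
  "l2_inner f g = (\<integral>t. f t * g t \<partial>unit_lebesgue)"

definition l2_norm :: "(real \<Rightarrow> real) \<Rightarrow> real" where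
  "l2_norm f = sqrt (l2_inner f f)"

text \<open>
  The Borel \<open>\<sigma>\<close>-algebra of the norm topology.  Its members are invariant under changes on
  null sets, so maps into or out of it are measurable exactly if the induced maps on the
  quotient \<open>L\<^sup>2[0,1]\<close> are.
\<close>

definition l2_open :: "(real \<Rightarrow> real) set \<Rightarrow> bool" where
  "l2_open U \<longleftrightarrow> U \<subseteq> L2 \<and>
     (\<forall>f\<in>U. \<exists>r>0. \<forall>g\<in>L2. l2_norm (\<lambda>t. g t - f t) < r \<longrightarrow> g \<in> U)"

definition L2_borel :: "(real \<Rightarrow> real) measure" where
  "L2_borel = sigma L2 {U. l2_open U}"

text \<open>The trigonometric basis is indexed by \<open>j \<ge> 1\<close>; the value at index \<open>0\<close> is never used.\<close>

definition trig :: "nat \<Rightarrow> real \<Rightarrow> real" where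
  "trig j s =
     (if j = 1 then 1
      else if even j then sqrt 2 * cos (2 * pi * real (j div 2) * s)
      else sqrt 2 * sin (2 * pi * real (j div 2) * s))"

text \<open>
  All weight sequences are indexed by \<open>j \<ge> 1\<close>, whence the shift in the series.  The value is
  extended real, as the series may diverge.
\<close>

definition wnorm2 :: "(nat \<Rightarrow> real) \<Rightarrow> (real \<Rightarrow> real) \<Rightarrow> ennreal" where
  "wnorm2 w f = (\<Sum>j. ennreal (w (Suc j) * \<bar>l2_inner f (trig (Suc j))\<bar>\<^sup>2))"

definition ellipsoid :: "(nat \<Rightarrow> real) \<Rightarrow> real \<Rightarrow> (real \<Rightarrow> real) set" where
  "ellipsoid w \<rho> = {f \<in> L2. wnorm2 w f \<le> ennreal \<rho>}"

definition eigen_class :: "(nat \<Rightarrow> real) \<Rightarrow> real \<Rightarrow> (nat \<Rightarrow> real) set" where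
  "eigen_class \<upsilon> d = {l. \<forall>j\<ge>1. 1 / d \<le> l j / \<upsilon> j \<and> l j / \<upsilon> j \<le> d}"


section \<open>The regressor\<close>

text \<open>
  \<open>X \<omega> t\<close> is the value at \<open>t\<close> of the random function.  Centring is the vanishing of the mean of
  \<open>X\<close> as an element of \<open>L\<^sup>2[0,1]\<close>.
\<close>

definition centered_regressor :: "'a measure \<Rightarrow> ('a \<Rightarrow> real \<Rightarrow> real) \<Rightarrow> bool" where
  "centered_regressor M X \<longleftrightarrow>
     X \<in> M \<rightarrow>\<^sub>M L2_borel \<and>
     integrable M (\<lambda>\<omega>. (l2_norm (X \<omega>))\<^sup>2) \<and>
     (\<forall>h\<in>L2. (\<integral>\<omega>. l2_inner (X \<omega>) h \<partial>M) = 0)"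

definition cov :: "'a measure \<Rightarrow> ('a \<Rightarrow> real) \<Rightarrow> ('a \<Rightarrow> real) \<Rightarrow> real" where
  "cov M U V = (\<integral>\<omega>. (U \<omega> - (\<integral>\<omega>'. U \<omega>' \<partial>M)) * (V \<omega> - (\<integral>\<omega>'. V \<omega>' \<partial>M)) \<partial>M)"

text \<open>
  Points whose differences all lie in \<open>[-1,1]\<close> can be translated into \<open>[0,1]\<close>.
\<close>

definition positive_definite :: "(real \<Rightarrow> real) \<Rightarrow> bool" where
  "positive_definite c \<longleftrightarrow>
     (\<forall>(m::nat) (t::nat \<Rightarrow> real) (a::nat \<Rightarrow> real).
        (\<forall>i<m. t i \<in> {0..1}) \<longrightarrow> 0 \<le> (\<Sum>i<m. \<Sum>j<m. a i * a j * c (t i - t j)))"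

definition second_order_stationary ::
    "'a measure \<Rightarrow> ('a \<Rightarrow> real \<Rightarrow> real) \<Rightarrow> (real \<Rightarrow> real) \<Rightarrow> bool" where
  "second_order_stationary M X c \<longleftrightarrow>
     (\<forall>t\<in>{0..1}. (\<lambda>\<omega>. X \<omega> t) \<in> borel_measurable M \<and> integrable M (\<lambda>\<omega>. (X \<omega> t)\<^sup>2)) \<and>
     (\<forall>t\<in>{0..1}. \<forall>s\<in>{0..1}. cov M (\<lambda>\<omega>. X \<omega> t) (\<lambda>\<omega>. X \<omega> s) = c (t - s)) \<and>
     positive_definite c"

definition cov_operator :: "'a measure \<Rightarrow> ('a \<Rightarrow> real \<Rightarrow> real) \<Rightarrow> (real \<Rightarrow> real) \<Rightarrow> real \<Rightarrow> real" where
  "cov_operator M X f s = (\<integral>t. cov M (\<lambda>\<omega>. X \<omega> t) (\<lambda>\<omega>. X \<omega> s) * f t \<partial>unit_lebesgue)"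

definition strictly_positive_operator :: "((real \<Rightarrow> real) \<Rightarrow> real \<Rightarrow> real) \<Rightarrow> bool" where
  "strictly_positive_operator T \<longleftrightarrow> (\<forall>f\<in>L2. l2_norm f \<noteq> 0 \<longrightarrow> 0 < l2_inner (T f) f)"

text \<open>The eigenvalue equation is an identity in \<open>L\<^sup>2[0,1]\<close>, that is, almost everywhere.\<close>

definition trig_eigenvalues ::
    "'a measure \<Rightarrow> ('a \<Rightarrow> real \<Rightarrow> real) \<Rightarrow> (nat \<Rightarrow> real) \<Rightarrow> bool" where
  "trig_eigenvalues M X l \<longleftrightarrow>
     (\<forall>j\<ge>1. (AE s in unit_lebesgue. cov_operator M X (trig j) s = l j * trig j s) \<and>
            l j = (\<integral>\<omega>. (l2_inner (X \<omega>) (trig j))\<^sup>2 \<partial>M) \<and> 0 < l j)"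


section \<open>The functional linear model\<close>

text \<open>Independence of the \<open>L\<^sup>2[0,1]\<close>-valued variable \<open>X\<close> and the real variable \<open>e\<close>.\<close>

definition indep_error :: "'a measure \<Rightarrow> ('a \<Rightarrow> real \<Rightarrow> real) \<Rightarrow> ('a \<Rightarrow> real) \<Rightarrow> bool" where
  "indep_error M X e \<longleftrightarrow>
     prob_space.indep_set M
       (sets (vimage_algebra (space M) X L2_borel))
       (sets (vimage_algebra (space M) e borel))"

definition response ::
    "('a \<Rightarrow> real \<Rightarrow> real) \<Rightarrow> ('a \<Rightarrow> real) \<Rightarrow> real \<Rightarrow> (real \<Rightarrow> real) \<Rightarrow> 'a \<Rightarrow> real" where
  "response X e \<sigma> \<beta> \<omega> = l2_inner \<beta> (X \<omega>) + \<sigma> * e \<omega>"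

definition pair_law ::
    "'a measure \<Rightarrow> ('a \<Rightarrow> real \<Rightarrow> real) \<Rightarrow> ('a \<Rightarrow> real) \<Rightarrow> real \<Rightarrow> (real \<Rightarrow> real) \<Rightarrow>
       (real \<times> (real \<Rightarrow> real)) measure" where
  "pair_law M X e \<sigma> \<beta> =
     distr M (borel \<Otimes>\<^sub>M L2_borel) (\<lambda>\<omega>. (response X e \<sigma> \<beta> \<omega>, X \<omega>))"

text \<open>The distribution of an i.i.d. sample \<open>(Y\<^sub>1,X\<^sub>1),\<dots>,(Y\<^sub>n,X\<^sub>n)\<close> under the slope \<open>\<beta>\<close>.\<close>

definition sample_law ::
    "nat \<Rightarrow> 'a measure \<Rightarrow> ('a \<Rightarrow> real \<Rightarrow> real) \<Rightarrow> ('a \<Rightarrow> real) \<Rightarrow> real \<Rightarrow> (real \<Rightarrow> real) \<Rightarrow>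
       (nat \<Rightarrow> real \<times> (real \<Rightarrow> real)) measure" where
  "sample_law n M X e \<sigma> \<beta> = PiM {1..n} (\<lambda>_. pair_law M X e \<sigma> \<beta>)"

definition estimators :: "nat \<Rightarrow> ((nat \<Rightarrow> real \<times> (real \<Rightarrow> real)) \<Rightarrow> real \<Rightarrow> real) set" where
  "estimators n = PiM {1..n} (\<lambda>_. borel \<Otimes>\<^sub>M L2_borel) \<rightarrow>\<^sub>M L2_borel"

definition risk ::
    "nat \<Rightarrow> 'a measure \<Rightarrow> ('a \<Rightarrow> real \<Rightarrow> real) \<Rightarrow> ('a \<Rightarrow> real) \<Rightarrow> real \<Rightarrow> (nat \<Rightarrow> real) \<Rightarrow>
       ((nat \<Rightarrow> real \<times> (real \<Rightarrow> real)) \<Rightarrow> real \<Rightarrow> real) \<Rightarrow> (real \<Rightarrow> real) \<Rightarrow> ennreal" where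
  "risk n M X e \<sigma> w b \<beta> = (\<integral>\<^sup>+z. wnorm2 w (\<lambda>t. b z t - \<beta> t) \<partial>sample_law n M X e \<sigma> \<beta>)"

end

theory Submission
  imports Defs
begin

text \<open>
  The bound comes from a finite family of slopes, a hypercube with the vertices
  \<open>\<beta>\<^sub>S = (\<Sum>j=1..k. \<plusminus> a\<^sub>j \<psi>\<^sub>j)\<close>, where \<open>S \<subseteq> {1..k}\<close> collects the indices with sign plus.  A risk that is
  small at all vertices would require to recover every single sign from the sample; this is
  impossible for amplitudes \<open>a\<^sub>j\<close> so small that flipping one sign hardly changes the law of the
  sample.  The choice \<open>a\<^sub>j\<^sup>2 = \<zeta> / (n \<upsilon>\<^sub>j)\<close> with \<open>\<zeta> = min (\<sigma>\<^sup>2/(2d)) (\<rho>/D)\<close> balances two demands.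

  \<^item> The vertices lie in the ellipsoid.  As \<open>\<gamma>/w\<close> is nondecreasing,
    \<open>\<Sum>\<^sub>j \<gamma>\<^sub>j a\<^sub>j\<^sup>2 \<le> \<zeta> \<gamma>\<^sub>k/(n w\<^sub>k) \<Sum>\<^sub>j w\<^sub>j/\<upsilon>\<^sub>j \<le> \<zeta> D \<le> \<rho>\<close>.
  \<^item> Neighbouring vertices are hard to distinguish.  Since the error is normal and independent of
    \<open>X\<close>, the laws of the sample under \<open>\<beta>\<close> and \<open>\<beta>'\<close> have Kullback-Leibler divergence
    \<open>n E\<langle>\<beta>' - \<beta>, X\<rangle>\<^sup>2 / (2 \<sigma>\<^sup>2)\<close>; when the sign \<open>j\<close> is flipped this is
    \<open>2 n a\<^sub>j\<^sup>2 \<lambda>\<^sub>j / \<sigma>\<^sup>2 \<le> 2 d \<zeta> / \<sigma>\<^sup>2 \<le> 1\<close>.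

  If the divergence is at most one, no statistic can estimate both of two numbers \<open>u\<close> and \<open>v\<close> well
  under their respective laws: the two mean squared errors add up to at least \<open>(u - v)\<^sup>2 / 8\<close>
  (\<open>two_point_square_risk\<close>).  Here \<open>u\<close> and \<open>v\<close> are the \<open>j\<close>-th coefficients \<open>\<plusminus> a\<^sub>j\<close>.  Averaging over
  all vertices and summing over \<open>j\<close> (\<open>assouad_averaging\<close>) shows that the supremum of the risk is at
  least \<open>\<Sum>\<^sub>j w\<^sub>j a\<^sub>j\<^sup>2 / 4 = (\<zeta>/4) (1/n) \<Sum>\<^sub>j w\<^sub>j/\<upsilon>\<^sub>j\<close> (\<open>hypercube_risk_lower_bound\<close>).  The
  last factor is at least \<open>\<delta>/D\<close> by the lower bound in the choice of \<open>k\<close>, and at least \<open>1/n\<close> because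
  of its first summand.
\<close>

section \<open>Two hypotheses at bounded Kullback-Leibler divergence\<close>

text \<open>
  With \<open>L = exp x\<close> as the likelihood ratio, the right-hand side is minimal in \<open>a\<close> at the weighted mean
  of \<open>u\<close> and \<open>v\<close>, with the value \<open>(u - v)\<^sup>2 L / (1 + L)\<close>.  This is at least
  \<open>(u - v)\<^sup>2 (2 s sqrt L - s\<^sup>2 (1 + L))\<close> for every \<open>s\<close>.  Taking \<open>s = 1/4\<close> and \<open>sqrt L \<ge> 1 + x/2\<close>
  yields a bound that involves only \<open>L\<close> and \<open>ln L\<close>, whose expectations are under control.
\<close>

lemma square_risk_pointwise:
  fixes a u v x :: real
  shows "(u - v)\<^sup>2 * (1/2 + x/4 - (1 + exp x)/16) \<le> (a - u)\<^sup>2 + exp x * (a - v)\<^sup>2"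
proof -
  define r where "r = exp (x/2)"
  have r: "exp x = r\<^sup>2" "r > 0"
    by (auto simp: r_def power2_eq_square simp flip: exp_add)
  have "1 + x/2 \<le> r"
    unfolding r_def by (rule exp_ge_add_one_self)
  then have "(1 + exp x) * (1/2 + x/4 - (1 + exp x)/16) \<le> (1 + r\<^sup>2) * (r/2 - (1 + r\<^sup>2)/16)"
    unfolding r(1) by (intro mult_left_mono) auto
  also have "\<dots> = r\<^sup>2 - (r - (1 + r\<^sup>2)/4)\<^sup>2"
    by (simp add: power2_eq_square field_simps)
  also have "\<dots> \<le> r\<^sup>2"
    by simp
  finally have "(u - v)\<^sup>2 * ((1 + exp x) * (1/2 + x/4 - (1 + exp x)/16)) \<le> (u - v)\<^sup>2 * r\<^sup>2"
    by (intro mult_left_mono) auto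
  \<comment> \<open>completing the square in \<open>a\<close>\<close>
  also have "(u - v)\<^sup>2 * r\<^sup>2 = (1 + r\<^sup>2) * ((a - u)\<^sup>2 + r\<^sup>2 * (a - v)\<^sup>2) - ((a - u) + r\<^sup>2 * (a - v))\<^sup>2"
    by (simp add: power2_eq_square algebra_simps)
  also have "\<dots> \<le> (1 + exp x) * ((a - u)\<^sup>2 + exp x * (a - v)\<^sup>2)"
    unfolding r(1) by simp
  finally have "(1 + exp x) * ((u - v)\<^sup>2 * (1/2 + x/4 - (1 + exp x)/16))
      \<le> (1 + exp x) * ((a - u)\<^sup>2 + exp x * (a - v)\<^sup>2)"
    by (simp add: algebra_simps)
  then show ?thesis
    using mult_le_cancel_left_pos[of "1 + exp x"] by (simp add: add_pos_pos)
qed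

text \<open>
  The extended integral on the right discards the negative part of \<open>g\<close>, so it can only be larger.
\<close>

lemma integral_le_nn_integral:
  fixes g :: "'a \<Rightarrow> real"
  assumes "integrable M g"
  shows "ennreal (integral\<^sup>L M g) \<le> (\<integral>\<^sup>+x. ennreal (g x) \<partial>M)"
proof -
  have "integral\<^sup>L M g \<le> (\<integral>x. max 0 (g x) \<partial>M)"
    using assms by (intro integral_mono) auto
  moreover have "(\<integral>\<^sup>+x. ennreal (max 0 (g x)) \<partial>M) = ennreal (\<integral>x. max 0 (g x) \<partial>M)"
    using assms by (intro nn_integral_eq_integral) auto
  moreover have "(\<integral>\<^sup>+x. ennreal (max 0 (g x)) \<partial>M) = (\<integral>\<^sup>+x. ennreal (g x) \<partial>M)"
    by (intro nn_integral_cong) (simp add: ennreal_max_0 max.commute)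
  ultimately show ?thesis
    by (simp add: ennreal_leI)
qed

text \<open>
  The hypothesis on \<open>ell\<close> says that the Kullback-Leibler divergence of \<open>P\<close> from \<open>Q\<close>, which is minus
  the mean of the log-likelihood ratio, is at most one.  The pointwise bound then integrates to
  \<open>(u - v)\<^sup>2 (1/2 - 1/4 - 2/16) = (u - v)\<^sup>2 / 8\<close>, because the likelihood ratio has mean one.
\<close>

lemma two_point_square_risk:
  fixes a ell :: "'a \<Rightarrow> real" and u v :: real
  assumes P: "prob_space P" and Q: "prob_space Q"
    and dens: "Q = density P (\<lambda>x. ennreal (exp (ell x)))"
    and a[measurable]: "a \<in> borel_measurable P"
    and ell: "integrable P ell" "-1 \<le> integral\<^sup>L P ell"
  shows "ennreal ((u - v)\<^sup>2 / 8)
    \<le> (\<integral>\<^sup>+x. ennreal ((a x - u)\<^sup>2) \<partial>P) + (\<integral>\<^sup>+x. ennreal ((a x - v)\<^sup>2) \<partial>Q)"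
proof -
  interpret P: prob_space P by fact
  interpret Q: prob_space Q by fact
  note [measurable] = borel_measurable_integrable[OF ell(1)]
  have "(\<integral>\<^sup>+x. ennreal (exp (ell x)) \<partial>P) = emeasure Q (space Q)"
    unfolding dens by (simp add: emeasure_density cong: nn_integral_cong)
  then have "(\<integral>\<^sup>+x. ennreal (exp (ell x)) \<partial>P) = ennreal 1"
    by (simp add: Q.emeasure_space_1)
  then have "has_bochner_integral P (\<lambda>x. exp (ell x)) 1"
    by (intro has_bochner_integral_nn_integral) auto
  then have E: "integrable P (\<lambda>x. exp (ell x))" "(\<integral>x. exp (ell x) \<partial>P) = 1"
    by (auto simp: has_bochner_integral_iff)
  define g where "g x = (u - v)\<^sup>2 * (1/2 + ell x/4 - (1 + exp (ell x))/16)" for x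
  have g: "integrable P g" and "integral\<^sup>L P g = (u - v)\<^sup>2 * (1/2 + integral\<^sup>L P ell/4 - 1/8)"
    using ell E unfolding g_def by (auto simp: P.prob_space)
  then have "ennreal ((u - v)\<^sup>2 / 8) \<le> ennreal (integral\<^sup>L P g)"
    using ell(2) mult_left_mono[of "1/8" "1/2 + integral\<^sup>L P ell/4 - 1/8" "(u - v)\<^sup>2"]
    by (intro ennreal_leI) simp
  also have "\<dots> \<le> (\<integral>\<^sup>+x. ennreal (g x) \<partial>P)"
    by (rule integral_le_nn_integral[OF g])
  also have "\<dots> \<le> (\<integral>\<^sup>+x. ennreal ((a x - u)\<^sup>2) + ennreal (exp (ell x)) * ennreal ((a x - v)\<^sup>2) \<partial>P)"
    unfolding g_def using square_risk_pointwise[of u v]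
    by (intro nn_integral_mono) (simp add: ennreal_leI flip: ennreal_mult ennreal_plus)
  also have "\<dots> = (\<integral>\<^sup>+x. ennreal ((a x - u)\<^sup>2) \<partial>P) + (\<integral>\<^sup>+x. ennreal ((a x - v)\<^sup>2) \<partial>Q)"
    unfolding dens by (subst nn_integral_add) (auto simp: nn_integral_density)
  finally show ?thesis .
qed

section \<open>Averaging over a hypercube\<close>

text \<open>
  Toggling the membership of \<open>j\<close> is an involution of the subsets of \<open>J\<close>.  Summed over all subsets, the
  bound on pairs of neighbours in direction \<open>j\<close> thus counts every \<open>R S j\<close> twice, while the total
  bound \<open>B\<close> is counted once for every subset.
\<close>

lemma assouad_averaging:
  fixes R :: "'i set \<Rightarrow> 'i \<Rightarrow> ennreal" and C :: "'i \<Rightarrow> ennreal"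
  assumes J: "finite J"
    and flip: "\<And>S j. S \<subseteq> J \<Longrightarrow> j \<in> J \<Longrightarrow> j \<notin> S \<Longrightarrow> C j \<le> R S j + R (insert j S) j"
    and total: "\<And>S. S \<subseteq> J \<Longrightarrow> (\<Sum>j\<in>J. R S j) \<le> B"
  shows "(\<Sum>j\<in>J. C j) \<le> 2 * B"
proof -
  define N where "N = of_nat (card (Pow J)) * (1 :: ennreal)"
  define toggle where "toggle j S = (if j \<in> S then S - {j} else insert j S)" for j and S :: "'i set"
  have toggle: "bij_betw (toggle j) (Pow J) (Pow J)" if "j \<in> J" for j
    using that by (intro bij_betw_byWitness[where f' = "toggle j"]) (auto simp: toggle_def)
  have C: "C j \<le> R S j + R (toggle j S) j" if "S \<subseteq> J" "j \<in> J" for S j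
    using flip[of S j] flip[of "S - {j}" j] that
    by (cases "j \<in> S") (auto simp: toggle_def insert_absorb add.commute)
  have "N * (\<Sum>j\<in>J. C j) = (\<Sum>j\<in>J. \<Sum>S\<in>Pow J. C j)"
    by (simp add: N_def sum_distrib_left)
  also have "\<dots> \<le> (\<Sum>j\<in>J. \<Sum>S\<in>Pow J. R S j + R (toggle j S) j)"
    by (intro sum_mono C) auto
  also have "\<dots> = (\<Sum>j\<in>J. 2 * (\<Sum>S\<in>Pow J. R S j))"
    by (intro sum.cong refl)
      (simp add: sum.distrib sum.reindex_bij_betw[OF toggle, of _ "\<lambda>S. R S _"] mult_2)
  also have "\<dots> = 2 * (\<Sum>S\<in>Pow J. \<Sum>j\<in>J. R S j)"
    by (subst sum.swap) (simp add: sum_distrib_left)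
  also have "\<dots> \<le> 2 * (\<Sum>S\<in>Pow J. B)"
    by (intro mult_left_mono sum_mono total) auto
  also have "\<dots> = N * (2 * B)"
    by (simp add: N_def mult_ac)
  finally show ?thesis
    using J by (subst (asm) ennreal_mult_le_mult_iff) (auto simp: N_def simp del: card_Pow)

qed

section \<open>Product measures with densities\<close>

text \<open>
  Both sides agree on boxes, where the integral of a product of functions of the single coordinates
  factorises.
\<close>

lemma PiM_density:
  fixes f :: "'a \<Rightarrow> ennreal"
  assumes I: "finite I"
    and P: "prob_space P" and Q: "prob_space Q"
    and f[measurable]: "f \<in> borel_measurable P" and dens: "Q = density P f"
  shows "PiM I (\<lambda>_. Q) = density (PiM I (\<lambda>_. P)) (\<lambda>z. \<Prod>i\<in>I. f (z i))"
proof -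
  interpret P: prob_space P by fact
  interpret Q: prob_space Q by fact
  interpret PP: product_sigma_finite "\<lambda>_. P" ..
  interpret QQ: product_sigma_finite "\<lambda>_. Q" ..
  have sets_Q: "sets Q = sets P"
    by (simp add: dens)
  show ?thesis
  proof (rule QQ.PiM_eqI[symmetric, OF I])
    show "sets (density (PiM I (\<lambda>_. P)) (\<lambda>z. \<Prod>i\<in>I. f (z i))) = sets (PiM I (\<lambda>_. Q))"
      by (simp add: sets_Q cong: sets_PiM_cong)
  next
    fix A :: "_ \<Rightarrow> 'a set"
    assume "\<And>i. i \<in> I \<Longrightarrow> A i \<in> sets Q"
    then have A[measurable]: "A i \<in> sets P" if "i \<in> I" for i
      using that by (simp add: sets_Q)
    have box: "(\<Prod>i\<in>I. f (z i)) * indicator (Pi\<^sub>E I A) z = (\<Prod>i\<in>I. f (z i) * indicator (A i) (z i))"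
      if "z \<in> space (PiM I (\<lambda>_. P))" for z
    proof (cases "\<forall>i\<in>I. z i \<in> A i")
      case True
      then show ?thesis
        using that by (auto simp: space_PiM PiE_iff intro!: prod.cong)
    next
      case False
      then have "(\<Prod>i\<in>I. f (z i) * indicator (A i) (z i)) = 0"
        using I by (intro prod_zero) (auto simp: indicator_def)
      then show ?thesis
        using False by (auto simp: indicator_def PiE_iff)
    qed
    have "emeasure (density (PiM I (\<lambda>_. P)) (\<lambda>z. \<Prod>i\<in>I. f (z i))) (Pi\<^sub>E I A)
        = (\<integral>\<^sup>+z. (\<Prod>i\<in>I. f (z i)) * indicator (Pi\<^sub>E I A) z \<partial>PiM I (\<lambda>_. P))"
      using I A by (intro emeasure_density sets_PiM_I_finite) auto
    also have "\<dots> = (\<integral>\<^sup>+z. (\<Prod>i\<in>I. f (z i) * indicator (A i) (z i)) \<partial>PiM I (\<lambda>_. P))"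
      by (intro nn_integral_cong box)
    also have "\<dots> = (\<Prod>i\<in>I. \<integral>\<^sup>+x. f x * indicator (A i) x \<partial>P)"
      using I by (intro PP.product_nn_integral_prod) auto
    also have "\<dots> = (\<Prod>i\<in>I. emeasure Q (A i))"
      unfolding dens by (intro prod.cong refl emeasure_density[symmetric]) auto
    finally show "emeasure (density (PiM I (\<lambda>_. P)) (\<lambda>z. \<Prod>i\<in>I. f (z i))) (Pi\<^sub>E I A)
        = (\<Prod>i\<in>I. emeasure Q (A i))" .
  qed
qed

section \<open>Square integrable functions\<close>

lemma L2_iff:
  "f \<in> L2 \<longleftrightarrow> f \<in> borel_measurable unit_lebesgue \<and> integrable unit_lebesgue (\<lambda>t. (f t)\<^sup>2)"
  by (simp add: L2_def)

lemma L2_mult_integrable: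
  assumes "f \<in> L2" "g \<in> L2"
  shows "integrable unit_lebesgue (\<lambda>t. f t * g t)"
proof (rule Bochner_Integration.integrable_bound)
  show "integrable unit_lebesgue (\<lambda>t. (f t)\<^sup>2 + (g t)\<^sup>2)"
    using assms by (auto simp: L2_iff)
  show "(\<lambda>t. f t * g t) \<in> borel_measurable unit_lebesgue"
    using assms by (auto simp: L2_iff)
  show "AE t in unit_lebesgue. norm (f t * g t) \<le> norm ((f t)\<^sup>2 + (g t)\<^sup>2)"
  proof (rule AE_I2)
    fix t
    have "2 * \<bar>f t\<bar> * \<bar>g t\<bar> \<le> (f t)\<^sup>2 + (g t)\<^sup>2"
      using sum_squares_bound[of "\<bar>f t\<bar>" "\<bar>g t\<bar>"] by simp
    then have "\<bar>f t\<bar> * \<bar>g t\<bar> \<le> (f t)\<^sup>2 + (g t)\<^sup>2"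
      using mult_nonneg_nonneg[OF abs_ge_zero abs_ge_zero, of "f t" "g t"] by linarith
    then show "norm (f t * g t) \<le> norm ((f t)\<^sup>2 + (g t)\<^sup>2)"
      by (simp add: abs_mult)
  qed
qed

lemma L2_lincomb:
  assumes "f \<in> L2" "g \<in> L2"
  shows "(\<lambda>t. a * f t + b * g t) \<in> L2"
proof -
  have "integrable unit_lebesgue (\<lambda>t. a\<^sup>2 * (f t)\<^sup>2 + 2 * a * b * (f t * g t) + b\<^sup>2 * (g t)\<^sup>2)"
    using assms L2_mult_integrable[OF assms] by (auto simp: L2_iff)
  also have "(\<lambda>t. a\<^sup>2 * (f t)\<^sup>2 + 2 * a * b * (f t * g t) + b\<^sup>2 * (g t)\<^sup>2)
      = (\<lambda>t. (a * f t + b * g t)\<^sup>2)"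
    by (simp add: power2_eq_square algebra_simps)
  finally show ?thesis
    using assms by (auto simp: L2_iff)
qed

lemma L2_diff: "f \<in> L2 \<Longrightarrow> g \<in> L2 \<Longrightarrow> (\<lambda>t. f t - g t) \<in> L2"
  using L2_lincomb[of f g 1 "-1"] by simp

lemma L2_sum:
  assumes "finite J" "\<And>j. j \<in> J \<Longrightarrow> f j \<in> L2"
  shows "(\<lambda>t. \<Sum>j\<in>J. a j * f j t) \<in> L2"
  using assms
proof (induction J rule: finite_induct)
  case empty
  then show ?case by (simp add: L2_iff)
next
  case (insert j J)
  then show ?case
    using L2_lincomb[of "f j" "\<lambda>t. \<Sum>j\<in>J. a j * f j t" "a j" 1] by simp
qed

lemma l2_inner_commute: "l2_inner f g = l2_inner g f"
  by (simp add: l2_inner_def mult.commute)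

lemma l2_inner_diff_left:
  "f \<in> L2 \<Longrightarrow> g \<in> L2 \<Longrightarrow> h \<in> L2 \<Longrightarrow> l2_inner (\<lambda>t. f t - g t) h = l2_inner f h - l2_inner g h"
  by (simp add: l2_inner_def left_diff_distrib L2_mult_integrable)

lemma l2_inner_sum_left:
  assumes "\<And>j. j \<in> J \<Longrightarrow> f j \<in> L2" "h \<in> L2"
  shows "l2_inner (\<lambda>t. \<Sum>j\<in>J. a j * f j t) h = (\<Sum>j\<in>J. a j * l2_inner (f j) h)"
proof -
  have "l2_inner (\<lambda>t. \<Sum>j\<in>J. a j * f j t) h = (\<integral>t. (\<Sum>j\<in>J. a j * (f j t * h t)) \<partial>unit_lebesgue)"
    by (simp add: l2_inner_def sum_distrib_right mult.assoc)
  also have "\<dots> = (\<Sum>j\<in>J. a j * l2_inner (f j) h)"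
    using assms by (simp add: l2_inner_def L2_mult_integrable)
  finally show ?thesis .
qed

lemma l2_norm_square: "(l2_norm f)\<^sup>2 = l2_inner f f"
proof -
  have "0 \<le> l2_inner f f"
    unfolding l2_inner_def by (intro integral_nonneg_AE) auto
  then show ?thesis by (simp add: l2_norm_def)
qed

text \<open>
  A substitute for the Cauchy-Schwarz inequality: the weight \<open>s\<close> is free, and a suitable
  choice yields continuity of the inner product.
\<close>

lemma l2_inner_young:
  assumes f: "f \<in> L2" and g: "g \<in> L2" and s: "s > 0"
  shows "2 * \<bar>l2_inner f g\<bar> \<le> s * (l2_norm f)\<^sup>2 + (l2_norm g)\<^sup>2 / s"
proof -
  have int: "integrable unit_lebesgue (\<lambda>t. s * (f t * f t) + g t * g t / s)"
    using L2_mult_integrable[OF f f] L2_mult_integrable[OF g g] by auto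
  have pt: "\<bar>2 * (f t * g t)\<bar> \<le> s * (f t * f t) + g t * g t / s" for t
  proof -
    have "0 \<le> (s * \<bar>f t\<bar> - \<bar>g t\<bar>)\<^sup>2 / s"
      using s by simp
    also have "\<dots> = s * (f t * f t) + g t * g t / s - \<bar>2 * (f t * g t)\<bar>"
      using s by (simp add: power2_eq_square field_simps abs_mult)
    finally show ?thesis by simp
  qed
  have "2 * \<bar>l2_inner f g\<bar> = \<bar>\<integral>t. 2 * (f t * g t) \<partial>unit_lebesgue\<bar>"
    by (simp add: l2_inner_def abs_mult)
  also have "\<dots> \<le> (\<integral>t. \<bar>2 * (f t * g t)\<bar> \<partial>unit_lebesgue)"
    by (rule integral_abs_bound)
  also have "\<dots> \<le> (\<integral>t. s * (f t * f t) + g t * g t / s \<partial>unit_lebesgue)"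
    using L2_mult_integrable[OF f g] int pt by (intro integral_mono) auto
  also have "\<dots> = s * l2_inner f f + l2_inner g g / s"
    using L2_mult_integrable[OF f f] L2_mult_integrable[OF g g]
    by (simp add: l2_inner_def)
  finally show ?thesis
    by (simp add: l2_norm_square)
qed

lemma space_L2_borel [simp]: "space L2_borel = L2"
  unfolding L2_borel_def by (intro space_measure_of) (auto simp: l2_open_def)

lemma l2_open_sets: "l2_open U \<Longrightarrow> U \<in> sets L2_borel"
  unfolding L2_borel_def by (intro in_measure_of) (auto simp: l2_open_def)

text \<open>
  The functional \<open>\<langle>h, \<cdot>\<rangle>\<close> is norm continuous, and the open sets of real numbers generate the
  \<open>\<sigma>\<close>-algebra on the other side.
\<close>

lemma l2_inner_measurable:
  assumes h: "h \<in> L2"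
  shows "l2_inner h \<in> L2_borel \<rightarrow>\<^sub>M borel"
proof (rule borel_measurableI)
  fix S :: "real set"
  assume S: "open S"
  show "l2_inner h -` S \<inter> space L2_borel \<in> sets L2_borel"
  proof (rule l2_open_sets, unfold l2_open_def, intro conjI ballI)
    show "l2_inner h -` S \<inter> space L2_borel \<subseteq> L2" by simp
    fix f
    assume "f \<in> l2_inner h -` S \<inter> space L2_borel"
    then have f: "f \<in> L2" "l2_inner h f \<in> S" by auto
    then obtain \<epsilon> where \<epsilon>: "\<epsilon> > 0" "ball (l2_inner h f) \<epsilon> \<subseteq> S"
      using S open_contains_ball by blast
    \<comment> \<open>the summand \<open>1\<close> covers the case that \<open>h\<close> has norm zero\<close>
    define s where "s = \<epsilon> / (1 + (l2_norm h)\<^sup>2)"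
    have s: "s > 0" "s * (l2_norm h)\<^sup>2 \<le> \<epsilon>"
      using \<epsilon>(1) by (auto simp: s_def field_simps add_pos_nonneg)
    show "\<exists>r>0. \<forall>g\<in>L2. l2_norm (\<lambda>t. g t - f t) < r \<longrightarrow> g \<in> l2_inner h -` S \<inter> space L2_borel"
    proof (intro exI[of _ "sqrt (s * \<epsilon>)"] conjI ballI impI)
      show "0 < sqrt (s * \<epsilon>)" using s \<epsilon> by simp
      fix g
      assume g: "g \<in> L2" and less: "l2_norm (\<lambda>t. g t - f t) < sqrt (s * \<epsilon>)"
      have d: "(\<lambda>t. g t - f t) \<in> L2"
        using g f by (intro L2_diff)
      have "0 \<le> l2_norm (\<lambda>t. g t - f t)"
        unfolding l2_norm_def l2_inner_def by (auto intro!: integral_nonneg_AE)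
      then have "(l2_norm (\<lambda>t. g t - f t))\<^sup>2 < (sqrt (s * \<epsilon>))\<^sup>2"
        using less by (intro power_strict_mono) auto
      then have "(l2_norm (\<lambda>t. g t - f t))\<^sup>2 / s < \<epsilon>"
        using s \<epsilon> by (simp add: field_simps)
      then have "\<bar>l2_inner h (\<lambda>t. g t - f t)\<bar> < \<epsilon>"
        using l2_inner_young[OF h d s(1)] s(2) by linarith
      also have "l2_inner h (\<lambda>t. g t - f t) = l2_inner h g - l2_inner h f"
        using l2_inner_diff_left[OF g f(1) h] by (simp add: l2_inner_commute)
      finally have "l2_inner h g \<in> ball (l2_inner h f) \<epsilon>"
        by (simp add: dist_real_def abs_minus_commute)
      then show "g \<in> l2_inner h -` S \<inter> space L2_borel"
        using \<epsilon> g by auto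
    qed
  qed
qed

section \<open>Orthonormality of the trigonometric basis\<close>

text \<open>
  Harmonics of nonzero frequency have a periodic antiderivative, so the fundamental theorem of
  calculus makes their integrals vanish.
\<close>

lemma integral_over_period:
  fixes F :: "real \<Rightarrow> real"
  assumes "\<And>t. (F has_real_derivative f t) (at t)" "continuous_on UNIV f" "F 0 = F 1"
  shows "integrable unit_lebesgue f" "(\<integral>t. f t \<partial>unit_lebesgue) = 0"
proof -
  show int: "integrable unit_lebesgue f"
    using assms(2) by (intro continuous_imp_integrable_real) (auto intro: continuous_on_subset)
  have "(f has_integral F 1 - F 0) {0..1}"
    using assms(1) by (intro fundamental_theorem_of_calculus)
      (auto simp: has_real_derivative_iff_has_vector_derivative[symmetric]
        intro: has_field_derivative_at_within)
  then show "(\<integral>t. f t \<partial>unit_lebesgue) = 0"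
    using has_integral_integral_lebesgue_on[OF int] assms(3) by (auto intro: has_integral_unique)
qed

lemma integral_cos_period:
  fixes m :: int
  shows "integrable unit_lebesgue (\<lambda>t. cos (2 * pi * m * t))"
    and "(\<integral>t. cos (2 * pi * m * t) \<partial>unit_lebesgue) = of_bool (m = 0)"
proof -
  have "integrable unit_lebesgue (\<lambda>t. cos (2 * pi * m * t)) \<and>
    (\<integral>t. cos (2 * pi * m * t) \<partial>unit_lebesgue) = of_bool (m = 0)"
  proof (cases "m = 0")
    case True
    then show ?thesis
      using continuous_imp_integrable_real[of 0 1 "\<lambda>_. 1 :: real"]
      by (simp add: measure_restrict_space)
  next
    case False
    have d: "((\<lambda>t. sin (2 * pi * m * t) / (2 * pi * m)) has_real_derivative cos (2 * pi * m * t)) (at t)" for t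
      using False by (auto intro!: derivative_eq_intros)
    have e: "sin (2 * pi * m * 0) / (2 * pi * m) = sin (2 * pi * m * 1) / (2 * pi * m)"
      using sin_int_2pin[of m] by simp
    have c: "continuous_on UNIV (\<lambda>t. cos (2 * pi * m * t))"
      by (intro continuous_intros)
    show ?thesis
      using integral_over_period[OF d c e] False by simp
  qed
  then show "integrable unit_lebesgue (\<lambda>t. cos (2 * pi * m * t))"
    "(\<integral>t. cos (2 * pi * m * t) \<partial>unit_lebesgue) = of_bool (m = 0)"
    by auto
qed

lemma integral_sin_period:
  fixes m :: int
  shows "integrable unit_lebesgue (\<lambda>t. sin (2 * pi * m * t))"
    and "(\<integral>t. sin (2 * pi * m * t) \<partial>unit_lebesgue) = 0"
proof -
  have "integrable unit_lebesgue (\<lambda>t. sin (2 * pi * m * t)) \<and>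
    (\<integral>t. sin (2 * pi * m * t) \<partial>unit_lebesgue) = 0"
  proof (cases "m = 0")
    case False
    have d: "((\<lambda>t. - cos (2 * pi * m * t) / (2 * pi * m)) has_real_derivative sin (2 * pi * m * t)) (at t)" for t
      using False by (auto intro!: derivative_eq_intros)
    have e: "- cos (2 * pi * m * 0) / (2 * pi * m) = - cos (2 * pi * m * 1) / (2 * pi * m)"
      using cos_int_2pin[of m] by simp
    have c: "continuous_on UNIV (\<lambda>t. sin (2 * pi * m * t))"
      by (intro continuous_intros)
    show ?thesis
      using integral_over_period[OF d c e] by simp
  qed simp
  then show "integrable unit_lebesgue (\<lambda>t. sin (2 * pi * m * t))"
    "(\<integral>t. sin (2 * pi * m * t) \<partial>unit_lebesgue) = 0"
    by auto
qed

lemma trig_L2: "trig j \<in> L2"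
proof -
  have c: "continuous_on {0..1} (trig j)"
    unfolding trig_def[abs_def]
    by (cases "j = 1"; cases "even j") (auto intro!: continuous_intros)
  then have "continuous_on {0..1} (\<lambda>t. (trig j t)\<^sup>2)"
    by (intro continuous_intros)
  with c show ?thesis
    using borel_measurable_integrable[OF continuous_imp_integrable_real]
    by (auto simp: L2_iff intro!: continuous_imp_integrable_real)
qed

text \<open>
  For \<open>i, j \<ge> 2\<close>, of frequencies \<open>p\<close> and \<open>q\<close>, the product-to-sum formulas turn
  \<open>\<psi>\<^sub>i \<psi>\<^sub>j\<close> into harmonics of the frequencies \<open>p + q\<close> and \<open>p - q\<close>.
  Among these only a cosine of frequency zero has a nonzero integral, and \<open>p + q\<close> is positive.
\<close>

lemma trig_orthonormal:
  assumes "i \<ge> 1" "j \<ge> 1"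
  shows "l2_inner (trig i) (trig j) = of_bool (i = j)"
proof -
  define p where "p = int (i div 2)"
  define q where "q = int (j div 2)"
  note ints = integral_cos_period integral_sin_period
  have two: "sqrt 2 * x * (sqrt 2 * y) = 2 * (x * y)" for x y :: real
  proof -
    have "sqrt 2 * x * (sqrt 2 * y) = (sqrt 2 * sqrt 2) * (x * y)"
      by (simp only: mult_ac)
    then show ?thesis by simp
  qed
  have prod_sum:
    "2 * (cos x * cos y) = cos (x - y) + cos (x + y)"
    "2 * (sin x * sin y) = cos (x - y) - cos (x + y)"
    "2 * (sin x * cos y) = sin (x + y) + sin (x - y)"
    "2 * (cos x * sin y) = sin (x + y) - sin (x - y)" for x y :: real
    by (simp_all add: cos_add cos_diff sin_add sin_diff)
  have freq: "2 * pi * real_of_int p * t + 2 * pi * real_of_int q * t = 2 * pi * real_of_int (p + q) * t"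
    "2 * pi * real_of_int p * t - 2 * pi * real_of_int q * t = 2 * pi * real_of_int (p - q) * t" for t
    by (simp_all add: algebra_simps)
  have ti: "trig i = (\<lambda>t. if even i then sqrt 2 * cos (2 * pi * p * t) else sqrt 2 * sin (2 * pi * p * t))"
    and p_pos: "p \<ge> 1" if "i \<noteq> 1"
    using that assms by (auto simp: trig_def p_def)
  have tj: "trig j = (\<lambda>t. if even j then sqrt 2 * cos (2 * pi * q * t) else sqrt 2 * sin (2 * pi * q * t))"
    and q_pos: "q \<ge> 1" if "j \<noteq> 1"
    using that assms by (auto simp: trig_def q_def)
  consider "i = 1" "j = 1" | "i = 1" "j \<noteq> 1" | "i \<noteq> 1" "j = 1" | "i \<noteq> 1" "j \<noteq> 1"
    by blast
  then show ?thesis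
  proof cases
    case 1
    then show ?thesis
      using ints(2)[of 0] by (simp add: l2_inner_def trig_def)
  next
    case 2
    then show ?thesis
      using ints[of q] q_pos unfolding l2_inner_def tj[OF 2(2)]
      by (cases "even j") (auto simp: trig_def)
  next
    case 3
    then show ?thesis
      using ints[of p] p_pos unfolding l2_inner_def ti[OF 3(1)]
      by (cases "even i") (auto simp: trig_def)
  next
    case 4
    have pq: "p + q \<noteq> 0"
      using p_pos q_pos 4 by auto
    \<comment> \<open>an index is determined by its frequency and its parity\<close>
    have same: "i = j \<longleftrightarrow> p = q" if "even i = even j"
      using that unfolding p_def q_def of_nat_eq_iff by presburger
    show ?thesis
      unfolding l2_inner_def ti[OF 4(1)] tj[OF 4(2)]
      using same pq
      by (cases "even i"; cases "even j") (auto simp: two prod_sum freq ints simp del: of_int_add of_int_diff)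
  qed
qed

section \<open>The law of one observation\<close>

definition log_likelihood_ratio ::
    "real \<Rightarrow> (real \<Rightarrow> real) \<Rightarrow> (real \<Rightarrow> real) \<Rightarrow> real \<times> (real \<Rightarrow> real) \<Rightarrow> real" where
  "log_likelihood_ratio \<sigma> \<beta> \<beta>' z =
     ((fst z - l2_inner \<beta> (snd z))\<^sup>2 - (fst z - l2_inner \<beta>' (snd z))\<^sup>2) / (2 * \<sigma>\<^sup>2)"

text \<open>
  The exponent is the log-likelihood ratio of two normal laws with common variance.
\<close>

lemma normal_density_change_mean:
  "normal_density m' \<sigma> y = normal_density m \<sigma> y * exp (((y - m)\<^sup>2 - (y - m')\<^sup>2) / (2 * \<sigma>\<^sup>2))"
  by (simp add: normal_density_def diff_divide_distrib flip: exp_add)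

text \<open>
  The part of the model that determines the law of the sample for a given slope.  Moments of \<open>X\<close> are
  added where they are used.
\<close>

locale gaussian_linear_model = prob_space M
  for M :: "'a measure" +
  fixes X :: "'a \<Rightarrow> real \<Rightarrow> real" and e :: "'a \<Rightarrow> real" and \<sigma> :: real
  assumes X_measurable[measurable]: "X \<in> M \<rightarrow>\<^sub>M L2_borel"
    and e_normal: "distributed M lborel e std_normal_density"
    and indep: "indep_error M X e"
    and \<sigma>_pos: "\<sigma> > 0"
begin

lemma e_measurable[measurable]: "e \<in> borel_measurable M"
  using distributed_measurable[OF e_normal] by simp

lemma indep_set_preimages:
  "indep_set (sets (vimage_algebra (space M) X L2_borel)) (sets (vimage_algebra (space M) e borel))"
  using indep by (simp add: indep_error_def)

text \<open>
  The variables \<open>X\<close> and \<open>e\<close> take values in different types, so the independence of the two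
  preimage algebras is turned into a product law directly on rectangles.
\<close>

lemma distr_X_e:
  "distr M L2_borel X \<Otimes>\<^sub>M distr M borel e = distr M (L2_borel \<Otimes>\<^sub>M borel) (\<lambda>\<omega>. (X \<omega>, e \<omega>))"
proof (rule pair_measure_eqI)
  show "sigma_finite_measure (distr M L2_borel X)" "sigma_finite_measure (distr M borel e)"
    by (auto intro!: prob_space_imp_sigma_finite prob_space_distr)
  show "sets (distr M L2_borel X \<Otimes>\<^sub>M distr M borel e)
      = sets (distr M (L2_borel \<Otimes>\<^sub>M borel) (\<lambda>\<omega>. (X \<omega>, e \<omega>)))"
    by (simp cong: sets_pair_measure_cong)
  fix A B
  assume "A \<in> sets (distr M L2_borel X)" "B \<in> sets (distr M borel e)"
  then have [measurable]: "A \<in> sets L2_borel" "B \<in> sets borel"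
    by auto
  have "prob ((X -` A \<inter> space M) \<inter> (e -` B \<inter> space M)) = prob (X -` A \<inter> space M) * prob (e -` B \<inter> space M)"
    by (intro indep_setD[OF indep_set_preimages] in_vimage_algebra) auto
  moreover have "(\<lambda>\<omega>. (X \<omega>, e \<omega>)) -` (A \<times> B) \<inter> space M = (X -` A \<inter> space M) \<inter> (e -` B \<inter> space M)"
    by auto
  ultimately show "emeasure (distr M L2_borel X) A * emeasure (distr M borel e) B
      = emeasure (distr M (L2_borel \<Otimes>\<^sub>M borel) (\<lambda>\<omega>. (X \<omega>, e \<omega>))) (A \<times> B)"
    by (simp add: emeasure_distr emeasure_eq_measure ennreal_mult)
qed

lemma indep_functional_e:
  assumes [measurable]: "h \<in> borel_measurable L2_borel"
  shows "indep_var borel (\<lambda>\<omega>. h (X \<omega>)) borel e"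
  unfolding indep_var_eq
proof (intro conjI)
  have sub: "sigma_sets (space M) {(\<lambda>\<omega>. h (X \<omega>)) -` A \<inter> space M |A. A \<in> sets borel}
      \<subseteq> sets (vimage_algebra (space M) X L2_borel)"
  proof -
    have "(\<lambda>\<omega>. h (X \<omega>)) -` A \<inter> space M \<in> sets (vimage_algebra (space M) X L2_borel)"
      if "A \<in> sets borel" for A
    proof -
      have "(\<lambda>\<omega>. h (X \<omega>)) -` A \<inter> space M = X -` (h -` A \<inter> space L2_borel) \<inter> space M"
        using measurable_space[OF X_measurable] by auto
      also have "\<dots> \<in> sets (vimage_algebra (space M) X L2_borel)"
        using measurable_sets[OF assms that] by (rule in_vimage_algebra)
      finally show ?thesis .
    qed
    then have "{(\<lambda>\<omega>. h (X \<omega>)) -` A \<inter> space M |A. A \<in> sets borel}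
        \<subseteq> sets (vimage_algebra (space M) X L2_borel)"
      by blast
    from sets.sigma_sets_subset[OF this] show ?thesis
      by simp
  qed
  show "indep_set (sigma_sets (space M) {(\<lambda>\<omega>. h (X \<omega>)) -` A \<inter> space M |A. A \<in> sets borel})
      (sigma_sets (space M) {e -` A \<inter> space M |A. A \<in> sets borel})"
    unfolding indep_set_def
    by (rule indep_sets_mono_sets[OF indep_set_preimages[unfolded indep_set_def]])
      (use sub in \<open>auto split: bool.split simp: sets_vimage_algebra\<close>)
qed measurable

lemma response_measurable[measurable]:
  assumes "\<beta> \<in> L2"
  shows "response X e \<sigma> \<beta> \<in> borel_measurable M"
proof -
  note [measurable] = l2_inner_measurable[OF assms]
  show ?thesis
    unfolding response_def[abs_def] by measurable
qed

lemma prob_space_pair_law: "\<beta> \<in> L2 \<Longrightarrow> prob_space (pair_law M X e \<sigma> \<beta>)"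
  unfolding pair_law_def by (intro prob_space_distr) measurable

lemma sets_pair_law[simp, measurable_cong]: "sets (pair_law M X e \<sigma> \<beta>) = sets (borel \<Otimes>\<^sub>M L2_borel)"
  by (simp add: pair_law_def)

text \<open>
  Given \<open>X = x\<close>, the response is normal with mean \<open>\<langle>\<beta>, x\<rangle>\<close> and standard deviation \<open>\<sigma>\<close>.  The
  reference measure does not depend on the slope, so that densities for different slopes can be
  divided by each other.
\<close>

lemma pair_law_eq_density:
  assumes \<beta>: "\<beta> \<in> L2"
  shows "pair_law M X e \<sigma> \<beta> = density (lborel \<Otimes>\<^sub>M distr M L2_borel X)
    (\<lambda>z. ennreal (normal_density (l2_inner \<beta> (snd z)) \<sigma> (fst z)))" (is "_ = density ?\<mu> ?p")
proof (rule measure_eqI)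
  note [measurable] = l2_inner_measurable[OF \<beta>]
  have [measurable]: "?p \<in> borel_measurable (borel \<Otimes>\<^sub>M L2_borel)"
    unfolding normal_density_def by measurable
  define PX where "PX = distr M L2_borel X"
  interpret PX: prob_space PX
    unfolding PX_def by (rule prob_space_distr) measurable
  have sets_PX[simp, measurable_cong]: "sets PX = sets L2_borel"
    by (simp add: PX_def)
  interpret base: pair_sigma_finite lborel PX ..
  have law_e: "distr M borel e = density lborel std_normal_density"
    using distributed_distr_eq_density[OF e_normal] by (simp cong: distr_cong)
  interpret N: prob_space "distr M borel e"
    by (rule prob_space_distr) measurable
  show "sets (pair_law M X e \<sigma> \<beta>) = sets (density ?\<mu> ?p)"
    by (simp add: pair_law_def cong: sets_pair_measure_cong)
  fix A
  assume "A \<in> sets (pair_law M X e \<sigma> \<beta>)"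
  then have A[measurable]: "A \<in> sets (borel \<Otimes>\<^sub>M L2_borel)"
    by simp
  define G where "G z = (indicator A (l2_inner \<beta> (fst z) + \<sigma> * snd z, fst z) :: ennreal)" for z
  have G[measurable]: "G \<in> borel_measurable (L2_borel \<Otimes>\<^sub>M borel)"
    unfolding G_def by measurable
  \<comment> \<open>substitution \<open>y = \<langle>\<beta>, x\<rangle> + \<sigma> t\<close> for a fixed value \<open>x\<close> of the regressor\<close>
  have fibre: "(\<integral>\<^sup>+t. G (x, t) \<partial>distr M borel e)
      = (\<integral>\<^sup>+y. ?p (y, x) * indicator A (y, x) \<partial>lborel)" if "x \<in> space PX" for x
  proof -
    have "(\<lambda>y. (y, x)) \<in> borel \<rightarrow>\<^sub>M borel \<Otimes>\<^sub>M L2_borel"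
      using that by (intro measurable_Pair measurable_const) (auto simp: PX_def)
    moreover have "(\<lambda>z. ?p z * indicator A z) \<in> borel_measurable (borel \<Otimes>\<^sub>M L2_borel)"
      by measurable
    ultimately have slice: "(\<lambda>y. ?p (y, x) * indicator A (y, x)) \<in> borel_measurable borel"
      by (rule measurable_compose)
    have "(\<lambda>t. (x, t)) \<in> borel \<rightarrow>\<^sub>M L2_borel \<Otimes>\<^sub>M borel"
      using that by (intro measurable_Pair measurable_const) (auto simp: PX_def)
    then have G_slice: "(\<lambda>t. G (x, t)) \<in> borel_measurable lborel"
      using measurable_compose[OF _ G] by simp
    have affine: "(\<lambda>t. c + \<sigma> * t) \<in> lborel \<rightarrow>\<^sub>M borel" for c
      by measurable
    have "(\<integral>\<^sup>+t. G (x, t) \<partial>distr M borel e) = (\<integral>\<^sup>+t. ennreal (std_normal_density t) * G (x, t) \<partial>lborel)"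
      unfolding law_e by (intro nn_integral_density G_slice) measurable
    also have "\<dots> = (\<integral>\<^sup>+t. ennreal \<sigma> *
        (?p (l2_inner \<beta> x + \<sigma> * t, x) * indicator A (l2_inner \<beta> x + \<sigma> * t, x)) \<partial>lborel)"
      using \<sigma>_pos
      by (intro nn_integral_cong)
        (auto simp: G_def normal_density_def real_sqrt_mult power_mult_distrib indicator_def
          simp flip: ennreal_mult)
    also have "\<dots> = ennreal \<sigma> * (\<integral>\<^sup>+t.
        ?p (l2_inner \<beta> x + \<sigma> * t, x) * indicator A (l2_inner \<beta> x + \<sigma> * t, x) \<partial>lborel)"
      by (intro nn_integral_cmult measurable_compose[OF affine slice])
    also have "\<dots> = (\<integral>\<^sup>+y. ?p (y, x) * indicator A (y, x) \<partial>lborel)"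
      using \<sigma>_pos nn_integral_real_affine[OF slice, of \<sigma> "l2_inner \<beta> x"] by simp
    finally show ?thesis .
  qed
  have "emeasure (pair_law M X e \<sigma> \<beta>) A = (\<integral>\<^sup>+\<omega>. indicator A (response X e \<sigma> \<beta> \<omega>, X \<omega>) \<partial>M)"
    using A \<beta> unfolding pair_law_def
    by (subst nn_integral_indicator[symmetric], simp, subst nn_integral_distr) auto
  also have "\<dots> = (\<integral>\<^sup>+\<omega>. G (X \<omega>, e \<omega>) \<partial>M)"
    by (simp add: G_def response_def)
  also have "\<dots> = (\<integral>\<^sup>+z. G z \<partial>distr M (L2_borel \<Otimes>\<^sub>M borel) (\<lambda>\<omega>. (X \<omega>, e \<omega>)))"
    by (subst nn_integral_distr) auto
  also have "\<dots> = (\<integral>\<^sup>+z. G z \<partial>(PX \<Otimes>\<^sub>M distr M borel e))"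
    unfolding PX_def distr_X_e ..
  also have "\<dots> = (\<integral>\<^sup>+x. \<integral>\<^sup>+t. G (x, t) \<partial>distr M borel e \<partial>PX)"
    by (intro N.nn_integral_fst[symmetric]) measurable
  also have "\<dots> = (\<integral>\<^sup>+x. \<integral>\<^sup>+y. ?p (y, x) * indicator A (y, x) \<partial>lborel \<partial>PX)"
    by (intro nn_integral_cong fibre)
  also have "\<dots> = (\<integral>\<^sup>+z. ?p z * indicator A z \<partial>(lborel \<Otimes>\<^sub>M PX))"
    by (intro base.nn_integral_snd[of "\<lambda>z. ?p z * indicator A z"]) measurable
  also have "\<dots> = emeasure (density ?\<mu> ?p) A"
    unfolding PX_def[symmetric] by (intro emeasure_density[symmetric]) measurable
  finally show "emeasure (pair_law M X e \<sigma> \<beta>) A = emeasure (density ?\<mu> ?p) A" .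
qed

lemma log_likelihood_ratio_measurable:
  assumes "\<beta> \<in> L2" "\<beta>' \<in> L2"
  shows "log_likelihood_ratio \<sigma> \<beta> \<beta>' \<in> borel_measurable (borel \<Otimes>\<^sub>M L2_borel)"
proof -
  note [measurable] = l2_inner_measurable[OF assms(1)] l2_inner_measurable[OF assms(2)]
  show ?thesis
    unfolding log_likelihood_ratio_def[abs_def] by measurable
qed

lemma pair_law_change_slope:
  assumes \<beta>: "\<beta> \<in> L2" and \<beta>': "\<beta>' \<in> L2"
  shows "pair_law M X e \<sigma> \<beta>' =
    density (pair_law M X e \<sigma> \<beta>) (\<lambda>z. ennreal (exp (log_likelihood_ratio \<sigma> \<beta> \<beta>' z)))"
proof -
  note [measurable] = l2_inner_measurable[OF \<beta>] l2_inner_measurable[OF \<beta>']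
    log_likelihood_ratio_measurable[OF \<beta> \<beta>']
  have [measurable]: "(\<lambda>z. ennreal (normal_density (l2_inner \<beta> (snd z)) \<sigma> (fst z)))
      \<in> borel_measurable (borel \<Otimes>\<^sub>M L2_borel)"
    unfolding normal_density_def by measurable
  have ratio: "ennreal (normal_density (l2_inner \<beta>' (snd z)) \<sigma> (fst z))
    = ennreal (normal_density (l2_inner \<beta> (snd z)) \<sigma> (fst z)) * ennreal (exp (log_likelihood_ratio \<sigma> \<beta> \<beta>' z))"
    for z :: "real \<times> (real \<Rightarrow> real)"
    unfolding log_likelihood_ratio_def
    by (subst normal_density_change_mean[where m = "l2_inner \<beta> (snd z)"]) (simp add: ennreal_mult)
  show ?thesis
    unfolding pair_law_eq_density[OF \<beta>] pair_law_eq_density[OF \<beta>']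
    by (subst density_density_eq) (measurable, simp add: ratio)
qed

text \<open>
  Minus this mean is the Kullback-Leibler divergence of the two pair laws.  At an observation generated by
  \<open>\<beta>\<close> and with \<open>h = \<langle>\<beta>' - \<beta>, X\<rangle>\<close> the log-likelihood ratio equals \<open>h e / \<sigma> - h\<^sup>2 / (2 \<sigma>\<^sup>2)\<close>,
  and the first term has mean zero because \<open>e\<close> is centred and independent of \<open>X\<close>.
\<close>

lemma log_likelihood_ratio_mean:
  assumes \<beta>: "\<beta> \<in> L2" and \<beta>': "\<beta>' \<in> L2"
    and sq: "integrable M (\<lambda>\<omega>. (l2_inner \<beta>' (X \<omega>) - l2_inner \<beta> (X \<omega>))\<^sup>2)"
  shows "integrable (pair_law M X e \<sigma> \<beta>) (log_likelihood_ratio \<sigma> \<beta> \<beta>')" (is ?int)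
    and "integral\<^sup>L (pair_law M X e \<sigma> \<beta>) (log_likelihood_ratio \<sigma> \<beta> \<beta>')
      = - expectation (\<lambda>\<omega>. (l2_inner \<beta>' (X \<omega>) - l2_inner \<beta> (X \<omega>))\<^sup>2) / (2 * \<sigma>\<^sup>2)" (is ?val)
proof -
  note [measurable] = l2_inner_measurable[OF \<beta>] l2_inner_measurable[OF \<beta>']
    log_likelihood_ratio_measurable[OF \<beta> \<beta>'] response_measurable[OF \<beta>]
  define h where "h x = l2_inner \<beta>' x - l2_inner \<beta> x" for x
  have [measurable]: "h \<in> borel_measurable L2_borel"
    unfolding h_def by measurable
  have sq': "integrable M (\<lambda>\<omega>. (h (X \<omega>))\<^sup>2)"
    using sq by (simp add: h_def)
  have int_h: "integrable M (\<lambda>\<omega>. h (X \<omega>))"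
    by (rule square_integrable_imp_integrable[OF _ sq']) measurable
  have int_e: "integrable M e"
    using distributed_integrable[OF e_normal, of "\<lambda>x. x", THEN iffD1]
      integrable_std_normal_moment[of 1] by simp
  have mean_e: "expectation e = 0"
    by (rule standard_normal_distributed_expectation[OF e_normal])
  have ind: "indep_var borel (\<lambda>\<omega>. h (X \<omega>)) borel e"
    by (rule indep_functional_e) measurable
  have mix: "integrable M (\<lambda>\<omega>. h (X \<omega>) * e \<omega>)" "expectation (\<lambda>\<omega>. h (X \<omega>) * e \<omega>) = 0"
    using indep_var_integrable[OF ind int_h int_e] indep_var_lebesgue_integral[OF ind int_h int_e] mean_e
    by simp_all
  have expand: "log_likelihood_ratio \<sigma> \<beta> \<beta>' (response X e \<sigma> \<beta> \<omega>, X \<omega>)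
    = h (X \<omega>) * e \<omega> / \<sigma> - (h (X \<omega>))\<^sup>2 / (2 * \<sigma>\<^sup>2)" for \<omega>
  proof -
    have "log_likelihood_ratio \<sigma> \<beta> \<beta>' (response X e \<sigma> \<beta> \<omega>, X \<omega>)
        = ((\<sigma> * e \<omega>)\<^sup>2 - (\<sigma> * e \<omega> - h (X \<omega>))\<^sup>2) / (2 * \<sigma>\<^sup>2)"
      by (simp add: log_likelihood_ratio_def response_def h_def algebra_simps)
    also have "(\<sigma> * e \<omega>)\<^sup>2 - (\<sigma> * e \<omega> - h (X \<omega>))\<^sup>2 = 2 * \<sigma> * (h (X \<omega>) * e \<omega>) - (h (X \<omega>))\<^sup>2"
      by (simp add: power2_eq_square algebra_simps)
    finally show ?thesis
      using \<sigma>_pos by (simp add: diff_divide_distrib power2_eq_square)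
  qed
  show ?int
    unfolding pair_law_def using mix sq' by (subst integrable_distr_eq) (auto simp: expand)
  show ?val
    unfolding pair_law_def using mix sq'
    by (subst integral_distr) (auto simp: expand simp flip: h_def)
qed

section \<open>The law of the sample\<close>

lemma sample_law_change_slope:
  assumes \<beta>: "\<beta> \<in> L2" and \<beta>': "\<beta>' \<in> L2"
  shows "sample_law n M X e \<sigma> \<beta>' = density (sample_law n M X e \<sigma> \<beta>)
    (\<lambda>z. ennreal (exp (\<Sum>i=1..n. log_likelihood_ratio \<sigma> \<beta> \<beta>' (z i))))"
proof -
  note [measurable] = log_likelihood_ratio_measurable[OF \<beta> \<beta>']
  show ?thesis
    unfolding sample_law_def
    by (subst PiM_density[OF _ prob_space_pair_law[OF \<beta>] prob_space_pair_law[OF \<beta>'] _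
          pair_law_change_slope[OF \<beta> \<beta>']])
      (auto simp: exp_sum prod_ennreal)
qed

text \<open>
  Kullback-Leibler divergence is additive over the independent observations, as every coordinate of
  the sample has the law of a single pair.
\<close>

lemma sample_log_likelihood_ratio_mean:
  assumes \<beta>: "\<beta> \<in> L2" and \<beta>': "\<beta>' \<in> L2"
    and sq: "integrable M (\<lambda>\<omega>. (l2_inner \<beta>' (X \<omega>) - l2_inner \<beta> (X \<omega>))\<^sup>2)"
  shows "integrable (sample_law n M X e \<sigma> \<beta>) (\<lambda>z. \<Sum>i=1..n. log_likelihood_ratio \<sigma> \<beta> \<beta>' (z i))" (is ?int)
    and "(\<integral>z. (\<Sum>i=1..n. log_likelihood_ratio \<sigma> \<beta> \<beta>' (z i)) \<partial>sample_law n M X e \<sigma> \<beta>)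
      = - real n * expectation (\<lambda>\<omega>. (l2_inner \<beta>' (X \<omega>) - l2_inner \<beta> (X \<omega>))\<^sup>2) / (2 * \<sigma>\<^sup>2)" (is ?val)
proof -
  note [measurable] = log_likelihood_ratio_measurable[OF \<beta> \<beta>']
  define P where "P = pair_law M X e \<sigma> \<beta>"
  define \<Lambda> where "\<Lambda> = log_likelihood_ratio \<sigma> \<beta> \<beta>'"
  have \<Lambda>: "integrable P \<Lambda>"
    "integral\<^sup>L P \<Lambda> = - expectation (\<lambda>\<omega>. (l2_inner \<beta>' (X \<omega>) - l2_inner \<beta> (X \<omega>))\<^sup>2) / (2 * \<sigma>\<^sup>2)"
    using log_likelihood_ratio_mean[OF \<beta> \<beta>' sq] by (simp_all add: P_def \<Lambda>_def)
  have [measurable]: "\<Lambda> \<in> borel_measurable P"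
    using \<Lambda>(1) by (rule borel_measurable_integrable)
  have marginal: "distr (PiM {1..n} (\<lambda>_. P)) P (\<lambda>z. z i) = P" if "i \<in> {1..n}" for i
    using that prob_space_pair_law[OF \<beta>] by (intro distr_PiM_component) (auto simp: P_def)
  have comp: "integrable (PiM {1..n} (\<lambda>_. P)) (\<lambda>z. \<Lambda> (z i)) \<and>
      (\<integral>z. \<Lambda> (z i) \<partial>PiM {1..n} (\<lambda>_. P)) = integral\<^sup>L P \<Lambda>" if i[measurable]: "i \<in> {1..n}" for i
  proof -
    have "integrable (distr (PiM {1..n} (\<lambda>_. P)) P (\<lambda>z. z i)) \<Lambda>"
      using \<Lambda>(1) marginal[OF i] by simp
    moreover have "integral\<^sup>L (distr (PiM {1..n} (\<lambda>_. P)) P (\<lambda>z. z i)) \<Lambda> = integral\<^sup>L P \<Lambda>"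
      using marginal[OF i] by simp
    ultimately show ?thesis
      using i by (simp add: integrable_distr_eq integral_distr)
  qed
  show ?int
    unfolding sample_law_def P_def[symmetric] \<Lambda>_def[symmetric] using comp by auto
  show ?val
    unfolding sample_law_def P_def[symmetric] \<Lambda>_def[symmetric] using comp \<Lambda>(2) by simp
qed

text \<open>
  The hypothesis \<open>close\<close> bounds the Kullback-Leibler divergence of the two sample laws by one.
\<close>

lemma sample_two_point_risk:
  assumes \<beta>: "\<beta> \<in> L2" and \<beta>': "\<beta>' \<in> L2"
    and sq: "integrable M (\<lambda>\<omega>. (l2_inner \<beta>' (X \<omega>) - l2_inner \<beta> (X \<omega>))\<^sup>2)"
    and close: "real n * expectation (\<lambda>\<omega>. (l2_inner \<beta>' (X \<omega>) - l2_inner \<beta> (X \<omega>))\<^sup>2) \<le> 2 * \<sigma>\<^sup>2"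
    and a: "a \<in> borel_measurable (PiM {1..n} (\<lambda>_. borel \<Otimes>\<^sub>M L2_borel))"
  shows "ennreal ((u - v)\<^sup>2 / 8) \<le> (\<integral>\<^sup>+z. ennreal ((a z - u)\<^sup>2) \<partial>sample_law n M X e \<sigma> \<beta>)
    + (\<integral>\<^sup>+z. ennreal ((a z - v)\<^sup>2) \<partial>sample_law n M X e \<sigma> \<beta>')"
proof (rule two_point_square_risk[OF _ _ sample_law_change_slope[OF \<beta> \<beta>']])
  show "prob_space (sample_law n M X e \<sigma> \<beta>)" "prob_space (sample_law n M X e \<sigma> \<beta>')"
    using \<beta> \<beta>' unfolding sample_law_def by (intro prob_space_PiM prob_space_pair_law; simp)+
  show "a \<in> borel_measurable (sample_law n M X e \<sigma> \<beta>)"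
    using a unfolding sample_law_def by (simp cong: measurable_cong_sets sets_PiM_cong)
  show "integrable (sample_law n M X e \<sigma> \<beta>) (\<lambda>z. \<Sum>i=1..n. log_likelihood_ratio \<sigma> \<beta> \<beta>' (z i))"
    by (rule sample_log_likelihood_ratio_mean(1)[OF \<beta> \<beta>' sq])
  show "- 1 \<le> (\<integral>z. (\<Sum>i=1..n. log_likelihood_ratio \<sigma> \<beta> \<beta>' (z i)) \<partial>sample_law n M X e \<sigma> \<beta>)"
    using close \<sigma>_pos by (subst sample_log_likelihood_ratio_mean(2)[OF \<beta> \<beta>' sq]) (simp add: field_simps)
qed

end

section \<open>Hypercubes of slopes\<close>

definition hypercube_coeff :: "(nat \<Rightarrow> real) \<Rightarrow> nat set \<Rightarrow> nat \<Rightarrow> real" where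
  "hypercube_coeff a S j = (if j \<in> S then a j else - a j)"

definition hypercube_slope :: "(nat \<Rightarrow> real) \<Rightarrow> nat \<Rightarrow> nat set \<Rightarrow> real \<Rightarrow> real" where
  "hypercube_slope a k S t = (\<Sum>j=1..k. hypercube_coeff a S j * trig j t)"

lemma hypercube_coeff_square [simp]: "(hypercube_coeff a S j)\<^sup>2 = (a j)\<^sup>2"
  by (simp add: hypercube_coeff_def)

lemma hypercube_slope_L2: "hypercube_slope a k S \<in> L2"
  unfolding hypercube_slope_def[abs_def] by (intro L2_sum trig_L2) auto

lemma l2_inner_hypercube_slope:
  "h \<in> L2 \<Longrightarrow> l2_inner (hypercube_slope a k S) h = (\<Sum>j=1..k. hypercube_coeff a S j * l2_inner (trig j) h)"
  unfolding hypercube_slope_def[abs_def] by (intro l2_inner_sum_left trig_L2)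

lemma hypercube_slope_trig:
  assumes "i \<ge> 1"
  shows "l2_inner (hypercube_slope a k S) (trig i) = (if i \<le> k then hypercube_coeff a S i else 0)"
proof -
  have "l2_inner (hypercube_slope a k S) (trig i)
      = (\<Sum>j=1..k. if j = i then hypercube_coeff a S j else 0)"
    unfolding l2_inner_hypercube_slope[OF trig_L2]
    using assms by (intro sum.cong refl) (auto simp: trig_orthonormal)
  then show ?thesis
    using assms by simp
qed

lemma hypercube_slope_neighbour:
  assumes "j \<in> {1..k}" "j \<notin> S" "h \<in> L2"
  shows "l2_inner (hypercube_slope a k (insert j S)) h - l2_inner (hypercube_slope a k S) h
    = 2 * a j * l2_inner (trig j) h"
proof -
  have "l2_inner (hypercube_slope a k (insert j S)) h - l2_inner (hypercube_slope a k S) h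
      = (\<Sum>i=1..k. if i = j then 2 * a i * l2_inner (trig i) h else 0)"
    unfolding l2_inner_hypercube_slope[OF assms(3)] sum_subtractf[symmetric]
    using assms(2) by (intro sum.cong refl) (auto simp: hypercube_coeff_def)
  then show ?thesis
    using assms(1) by simp
qed

lemma hypercube_slope_in_ellipsoid:
  assumes w: "\<And>j. j \<ge> 1 \<Longrightarrow> w j \<ge> 0" and le: "(\<Sum>j=1..k. w j * (a j)\<^sup>2) \<le> \<rho>"
  shows "hypercube_slope a k S \<in> ellipsoid w \<rho>"
proof -
  have "wnorm2 w (hypercube_slope a k S)
      = (\<Sum>j<k. ennreal (w (Suc j) * \<bar>l2_inner (hypercube_slope a k S) (trig (Suc j))\<bar>\<^sup>2))"
    unfolding wnorm2_def by (intro suminf_finite) (auto simp: hypercube_slope_trig)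
  also have "\<dots> = (\<Sum>j<k. ennreal (w (Suc j) * (a (Suc j))\<^sup>2))"
    by (intro sum.cong refl) (auto simp: hypercube_slope_trig)
  also have "\<dots> = ennreal (\<Sum>j=1..k. w j * (a j)\<^sup>2)"
    using w by (subst sum_ennreal) (auto simp: sum.atLeast1_atMost_eq)
  also have "\<dots> \<le> ennreal \<rho>"
    using le by (rule ennreal_leI)
  finally show ?thesis
    by (simp add: ellipsoid_def hypercube_slope_L2)
qed

text \<open>
  The loss dominates the weighted squared errors of the first \<open>k\<close> coefficients, which are the only
  ones on which the hypercube slopes differ.
\<close>

lemma wnorm2_ge_partial_sum:
  assumes "f \<in> L2" "g \<in> L2"
  shows "(\<Sum>j=1..k. ennreal (w j * (l2_inner (trig j) f - l2_inner g (trig j))\<^sup>2)) \<le> wnorm2 w (\<lambda>t. f t - g t)"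
proof -
  have "(\<Sum>j=1..k. ennreal (w j * (l2_inner (trig j) f - l2_inner g (trig j))\<^sup>2))
      = (\<Sum>j<k. ennreal (w (Suc j) * \<bar>l2_inner (\<lambda>t. f t - g t) (trig (Suc j))\<bar>\<^sup>2))"
    unfolding l2_inner_diff_left[OF assms trig_L2]
    by (simp add: sum.atLeast1_atMost_eq l2_inner_commute[of "trig _" f])
  also have "\<dots> \<le> wnorm2 w (\<lambda>t. f t - g t)"
    unfolding wnorm2_def by (rule sum_le_suminf) auto
  finally show ?thesis .
qed

context gaussian_linear_model
begin

text \<open>
  The hypothesis \<open>info\<close> keeps the Kullback-Leibler divergence between neighbouring vertices at most one:
  their difference \<open>2 a\<^sub>j \<psi>\<^sub>j\<close> has the divergence \<open>n (2 a\<^sub>j)\<^sup>2 \<lambda>\<^sub>j / (2 \<sigma>\<^sup>2)\<close>.  Every pair of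
  neighbours in direction \<open>j\<close> then contributes \<open>w\<^sub>j (2 a\<^sub>j)\<^sup>2 / 8\<close> to the sum of its two risks, hence
  a vertex contributes half of this on average.
\<close>

lemma hypercube_risk_lower_bound:
  assumes b: "b \<in> estimators n"
    and w: "\<And>j. j \<ge> 1 \<Longrightarrow> w j \<ge> 0"
    and sq: "\<And>j. j \<in> {1..k} \<Longrightarrow> integrable M (\<lambda>\<omega>. (l2_inner (X \<omega>) (trig j))\<^sup>2)"
    and info: "\<And>j. j \<in> {1..k} \<Longrightarrow>
      2 * real n * (a j)\<^sup>2 * expectation (\<lambda>\<omega>. (l2_inner (X \<omega>) (trig j))\<^sup>2) \<le> \<sigma>\<^sup>2"
    and B: "\<And>S. S \<subseteq> {1..k} \<Longrightarrow> risk n M X e \<sigma> w b (hypercube_slope a k S) \<le> B"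
  shows "ennreal ((\<Sum>j=1..k. w j * (a j)\<^sup>2) / 4) \<le> B"
proof -
  let ?slope = "hypercube_slope a k" and ?coeff = "hypercube_coeff a"
  let ?law = "\<lambda>S. sample_law n M X e \<sigma> (?slope S)"
  have b_measurable[measurable]: "b \<in> PiM {1..n} (\<lambda>_. borel \<Otimes>\<^sub>M L2_borel) \<rightarrow>\<^sub>M L2_borel"
    using b by (simp add: estimators_def)
  have sets_law[measurable_cong]: "sets (?law S) = sets (PiM {1..n} (\<lambda>_. borel \<Otimes>\<^sub>M L2_borel))" for S
    unfolding sample_law_def by (intro sets_PiM_cong) auto
  have coord[measurable]: "(\<lambda>z. l2_inner (trig j) (b z)) \<in> borel_measurable (PiM {1..n} (\<lambda>_. borel \<Otimes>\<^sub>M L2_borel))" for j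
    by (rule measurable_compose[OF b_measurable l2_inner_measurable[OF trig_L2]])
  define R where
    "R S j = (\<integral>\<^sup>+z. ennreal ((l2_inner (trig j) (b z) - ?coeff S j)\<^sup>2) \<partial>?law S)" for S j
  have total: "(\<Sum>j=1..k. ennreal (w j) * R S j) \<le> B" if "S \<subseteq> {1..k}" for S
  proof -
    have "(\<Sum>j=1..k. ennreal (w j) * R S j)
        = (\<integral>\<^sup>+z. (\<Sum>j=1..k. ennreal (w j * (l2_inner (trig j) (b z) - ?coeff S j)\<^sup>2)) \<partial>?law S)"
      unfolding R_def using w
      by (simp add: nn_integral_sum nn_integral_cmult[symmetric] ennreal_mult)
    also have "\<dots> \<le> risk n M X e \<sigma> w b (?slope S)"
      unfolding risk_def
    proof (rule nn_integral_mono)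
      fix z
      assume "z \<in> space (?law S)"
      then have "b z \<in> L2"
        using measurable_space[OF b_measurable] sets_eq_imp_space_eq[OF sets_law] by simp
      then have "(\<Sum>j=1..k. ennreal (w j * (l2_inner (trig j) (b z) - l2_inner (?slope S) (trig j))\<^sup>2))
          \<le> wnorm2 w (\<lambda>t. b z t - ?slope S t)"
        by (rule wnorm2_ge_partial_sum[OF _ hypercube_slope_L2])
      then show "(\<Sum>j=1..k. ennreal (w j * (l2_inner (trig j) (b z) - ?coeff S j)\<^sup>2))
          \<le> wnorm2 w (\<lambda>t. b z t - ?slope S t)"
        by (simp add: hypercube_slope_trig)
    qed
    also have "\<dots> \<le> B"
      by (rule B[OF that])
    finally show ?thesis .
  qed
  have pair: "ennreal (w j * (a j)\<^sup>2 / 2) \<le> ennreal (w j) * R S j + ennreal (w j) * R (insert j S) j"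
    if j: "j \<in> {1..k}" "j \<notin> S" for S j
  proof -
    have diff: "l2_inner (?slope (insert j S)) (X \<omega>) - l2_inner (?slope S) (X \<omega>)
        = 2 * a j * l2_inner (X \<omega>) (trig j)" if "\<omega> \<in> space M" for \<omega>
      using hypercube_slope_neighbour[OF j, of "X \<omega>" a] measurable_space[OF X_measurable that]
      by (simp add: l2_inner_commute[of "trig j"])
    have int: "integrable M (\<lambda>\<omega>. (l2_inner (?slope (insert j S)) (X \<omega>) - l2_inner (?slope S) (X \<omega>))\<^sup>2)"
      using sq[OF j(1)]
      by (subst Bochner_Integration.integrable_cong[OF refl, where g = "\<lambda>\<omega>. 4 * (a j)\<^sup>2 * (l2_inner (X \<omega>) (trig j))\<^sup>2"])
        (simp_all add: diff power_mult_distrib)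
    have "expectation (\<lambda>\<omega>. (l2_inner (?slope (insert j S)) (X \<omega>) - l2_inner (?slope S) (X \<omega>))\<^sup>2)
        = expectation (\<lambda>\<omega>. 4 * (a j)\<^sup>2 * (l2_inner (X \<omega>) (trig j))\<^sup>2)"
      by (intro Bochner_Integration.integral_cong refl) (simp add: diff power_mult_distrib)
    then have close: "real n * expectation (\<lambda>\<omega>. (l2_inner (?slope (insert j S)) (X \<omega>) - l2_inner (?slope S) (X \<omega>))\<^sup>2)
        \<le> 2 * \<sigma>\<^sup>2"
      using info[OF j(1)] by (simp add: mult_ac)
    have "ennreal ((?coeff S j - ?coeff (insert j S) j)\<^sup>2 / 8) \<le> R S j + R (insert j S) j"
      unfolding R_def
      by (rule sample_two_point_risk[OF hypercube_slope_L2 hypercube_slope_L2 int close coord])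
    moreover have "(?coeff S j - ?coeff (insert j S) j)\<^sup>2 / 8 = (a j)\<^sup>2 / 2"
      using j(2) by (simp add: hypercube_coeff_def power2_eq_square)
    ultimately have "ennreal (w j) * ennreal ((a j)\<^sup>2 / 2) \<le> ennreal (w j) * (R S j + R (insert j S) j)"
      by (intro mult_left_mono) auto
    then show ?thesis
      using w[of j] j(1) by (simp add: distrib_left flip: ennreal_mult)
  qed
  have "(\<Sum>j=1..k. ennreal (w j * (a j)\<^sup>2 / 2)) \<le> 2 * B"
    by (rule assouad_averaging[where R = "\<lambda>S j. ennreal (w j) * R S j"])
      (use pair total in auto)
  also have "(\<Sum>j=1..k. ennreal (w j * (a j)\<^sup>2 / 2)) = ennreal (\<Sum>j=1..k. w j * (a j)\<^sup>2 / 2)"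
    using w by (intro sum_ennreal) auto
  also have "(\<Sum>j=1..k. w j * (a j)\<^sup>2 / 2) = 2 * ((\<Sum>j=1..k. w j * (a j)\<^sup>2) / 4)"
    by (simp flip: sum_divide_distrib)
  also have "ennreal \<dots> = 2 * ennreal ((\<Sum>j=1..k. w j * (a j)\<^sup>2) / 4)"
    using w by (subst ennreal_mult) (auto intro!: sum_nonneg)
  finally show ?thesis
    by (subst (asm) ennreal_mult_le_mult_iff) auto
qed

end

section \<open>The lower bound for the minimax risk\<close>

theorem theorem3p2:
  fixes M :: "'a measure" and X :: "'a \<Rightarrow> real \<Rightarrow> real" and e :: "'a \<Rightarrow> real"
    and c :: "real \<Rightarrow> real" and l w \<gamma> \<upsilon> :: "nat \<Rightarrow> real"
    and \<sigma> \<rho> d D \<delta> :: real and n k :: nat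
    and b :: "(nat \<Rightarrow> real \<times> (real \<Rightarrow> real)) \<Rightarrow> real \<Rightarrow> real"
  assumes "prob_space M" and "\<sigma> > 0" and "\<rho> > 0" and "d \<ge> 1" and "D \<ge> 1" and "n \<ge> 1"
    and "centered_regressor M X"
    and "second_order_stationary M X c"
    and "strictly_positive_operator (cov_operator M X)"
    and "trig_eigenvalues M X l"
    and "distributed M lborel e std_normal_density"
    and "indep_error M X e"
    and "\<And>j. j \<ge> 1 \<Longrightarrow> w j > 0" and "\<And>j. j \<ge> 1 \<Longrightarrow> \<gamma> j > 0" and "\<And>j. j \<ge> 1 \<Longrightarrow> \<upsilon> j > 0"
    and "w 1 = 1" and "\<gamma> 1 = 1" and "\<upsilon> 1 = 1"
    and "mono_on {1..} \<gamma>"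
    and "mono_on {1..} (\<lambda>j. \<gamma> j / w j)"
    and "antimono_on {1..} \<upsilon>"
    and "summable (\<lambda>j. \<upsilon> (Suc j))"
    and "l \<in> eigen_class \<upsilon> d"
    and "k \<ge> 1"
    and "1 / D \<le> \<gamma> k / (real n * w k) * (\<Sum>j=1..k. w j / \<upsilon> j)"
    and "\<gamma> k / (real n * w k) * (\<Sum>j=1..k. w j / \<upsilon> j) \<le> D"
    and "\<delta> = w k / \<gamma> k"
    and "b \<in> estimators n"
  shows "(SUP \<beta>\<in>ellipsoid \<gamma> \<rho>. risk n M X e \<sigma> w b \<beta>)
           \<ge> ennreal (1 / (4 * D) * min (\<sigma>\<^sup>2 / (2 * d)) (\<rho> / D) * max \<delta> (1 / real n))"
proof -
  interpret gaussian_linear_model M X e \<sigma>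
    using assms by (intro gaussian_linear_model.intro gaussian_linear_model_axioms.intro)
      (auto simp: centered_regressor_def)
  note w_pos = \<open>\<And>j. j \<ge> 1 \<Longrightarrow> w j > 0\<close> and \<gamma>_pos = \<open>\<And>j. j \<ge> 1 \<Longrightarrow> \<gamma> j > 0\<close>
    and \<upsilon>_pos = \<open>\<And>j. j \<ge> 1 \<Longrightarrow> \<upsilon> j > 0\<close>
  \<comment> \<open>the two bounds in the minimum keep neighbours indistinguishable and the vertices in the ellipsoid\<close>
  define \<zeta> where "\<zeta> = min (\<sigma>\<^sup>2 / (2 * d)) (\<rho> / D)"
  define a where "a j = sqrt (\<zeta> / (real n * \<upsilon> j))" for j
  define V where "V = (\<Sum>j=1..k. w j / \<upsilon> j)"
  have \<zeta>: "\<zeta> > 0" "2 * d * \<zeta> \<le> \<sigma>\<^sup>2" "\<zeta> * D \<le> \<rho>"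
    using assms(2-5) unfolding \<zeta>_def by (auto simp: min_def field_simps)
  have n: "real n \<ge> 1"
    using \<open>n \<ge> 1\<close> by simp
  have a_square: "(a j)\<^sup>2 = \<zeta> / (real n * \<upsilon> j)" if "j \<ge> 1" for j
    using \<zeta>(1) n \<upsilon>_pos[OF that] by (simp add: a_def)
  have weighted: "(\<Sum>j=1..k. w j * (a j)\<^sup>2) = \<zeta> / real n * V"
    unfolding V_def sum_distrib_left by (intro sum.cong refl) (simp add: a_square)

  have ellipsoid: "hypercube_slope a k S \<in> ellipsoid \<gamma> \<rho>" for S
  proof (rule hypercube_slope_in_ellipsoid)
    have "\<gamma> j * (a j)\<^sup>2 \<le> \<zeta> * (\<gamma> k / (real n * w k)) * (w j / \<upsilon> j)" if j: "j \<in> {1..k}" for j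
    proof -
      have "\<gamma> j / w j \<le> \<gamma> k / w k"
        using j \<open>mono_on {1..} (\<lambda>j. \<gamma> j / w j)\<close> by (auto simp: mono_on_def)
      then have "\<gamma> j / w j * (\<zeta> / real n * (w j / \<upsilon> j)) \<le> \<gamma> k / w k * (\<zeta> / real n * (w j / \<upsilon> j))"
        using j \<zeta>(1) w_pos[of j] \<upsilon>_pos[of j] by (intro mult_right_mono) auto
      then show ?thesis
        using j w_pos[of j] by (simp add: a_square mult_ac)
    qed
    then have "(\<Sum>j=1..k. \<gamma> j * (a j)\<^sup>2) \<le> (\<Sum>j=1..k. \<zeta> * (\<gamma> k / (real n * w k)) * (w j / \<upsilon> j))"
      by (rule sum_mono)
    also have "\<dots> = \<zeta> * (\<gamma> k / (real n * w k) * V)"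
      unfolding V_def by (simp add: sum_distrib_left mult.assoc)
    also have "\<dots> \<le> \<zeta> * D"
      unfolding V_def using \<zeta>(1) \<open>\<gamma> k / (real n * w k) * (\<Sum>j=1..k. w j / \<upsilon> j) \<le> D\<close> by (intro mult_left_mono) auto
    finally show "(\<Sum>j=1..k. \<gamma> j * (a j)\<^sup>2) \<le> \<rho>"
      using \<zeta>(3) by simp
  qed (use \<gamma>_pos in \<open>simp add: less_imp_le\<close>)

  have eigen: "l j = expectation (\<lambda>\<omega>. (l2_inner (X \<omega>) (trig j))\<^sup>2)" "l j > 0" if "j \<ge> 1" for j
    using \<open>trig_eigenvalues M X l\<close> that by (auto simp: trig_eigenvalues_def)

  have bound: "ennreal ((\<Sum>j=1..k. w j * (a j)\<^sup>2) / 4) \<le> (SUP \<beta>\<in>ellipsoid \<gamma> \<rho>. risk n M X e \<sigma> w b \<beta>)"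
  proof (rule hypercube_risk_lower_bound[OF \<open>b \<in> estimators n\<close>])
    \<comment> \<open>a nonzero Bochner integral is the integral of an integrable function\<close>
    show "integrable M (\<lambda>\<omega>. (l2_inner (X \<omega>) (trig j))\<^sup>2)" if "j \<in> {1..k}" for j
      using eigen[of j] that not_integrable_integral_eq[of M "\<lambda>\<omega>. (l2_inner (X \<omega>) (trig j))\<^sup>2"]
      by fastforce
    show "2 * real n * (a j)\<^sup>2 * expectation (\<lambda>\<omega>. (l2_inner (X \<omega>) (trig j))\<^sup>2) \<le> \<sigma>\<^sup>2"
      if j: "j \<in> {1..k}" for j
    proof -
      have "2 * real n * (a j)\<^sup>2 * l j = 2 * \<zeta> * (l j / \<upsilon> j)"
        using j n by (simp add: a_square)
      also have "\<dots> \<le> 2 * \<zeta> * d"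
        using j \<zeta>(1) \<open>l \<in> eigen_class \<upsilon> d\<close> by (intro mult_left_mono) (auto simp: eigen_class_def)
      finally show ?thesis
        using \<zeta>(2) eigen(1)[of j] j by (simp add: mult_ac)
    qed
    show "risk n M X e \<sigma> w b (hypercube_slope a k S) \<le> (SUP \<beta>\<in>ellipsoid \<gamma> \<rho>. risk n M X e \<sigma> w b \<beta>)"
      for S
      by (rule SUP_upper[OF ellipsoid])
  qed (use w_pos in \<open>simp add: less_imp_le\<close>)

  have \<delta>: "\<delta> / D \<le> V / real n"
    using \<open>1 / D \<le> \<gamma> k / (real n * w k) * (\<Sum>j=1..k. w j / \<upsilon> j)\<close> n w_pos[OF \<open>k \<ge> 1\<close>] \<gamma>_pos[OF \<open>k \<ge> 1\<close>] \<open>D \<ge> 1\<close>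
    unfolding \<open>\<delta> = w k / \<gamma> k\<close> V_def by (simp add: field_simps)
  \<comment> \<open>the first summand alone accounts for the parametric rate \<open>1/n\<close>\<close>
  have "w 1 / \<upsilon> 1 \<le> V"
    unfolding V_def using \<open>k \<ge> 1\<close> w_pos \<upsilon>_pos
    by (intro member_le_sum) (auto simp: less_imp_le)
  then have "1 / D \<le> V"
    using \<open>w 1 = 1\<close> \<open>\<upsilon> 1 = 1\<close> \<open>D \<ge> 1\<close> by (simp add: order.trans[of "1 / D" 1])
  then have "(1 / real n) / D \<le> V / real n"
    using n by (simp add: field_simps)
  with \<delta> have "max \<delta> (1 / real n) / D \<le> V / real n"
    by (simp add: max_def)
  then have "\<zeta> / 4 * (max \<delta> (1 / real n) / D) \<le> \<zeta> / 4 * (V / real n)"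
    using \<zeta>(1) by (intro mult_left_mono) auto
  then have "1 / (4 * D) * \<zeta> * max \<delta> (1 / real n) \<le> (\<Sum>j=1..k. w j * (a j)\<^sup>2) / 4"
    unfolding weighted by (simp add: mult_ac)
  from order.trans[OF ennreal_leI[OF this] bound] show ?thesis
    unfolding \<zeta>_def .
qed

end
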